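(* Let $G$ be a standard reductive group over $\Bbbk$ with Lie algebra $\mathfrak g$, let $m>0$, and let $x=\sum_{i=0}^m x_it^i\in\mathfrak g_m$ with $x_i\in\mathfrak g$. Then $x_0$ is a regular element of $\mathfrak g$ if and only if $x$ is a regular element of $\mathfrak g_m$.
   Context: $\Bbbk$ is an algebraically closed field of characteristic $p>0$. A standard reductive group $G$ is a connected reductive algebraic group over $\Bbbk$ such that (H1) the derived subgroup of $G$ is simply connected, (H2) $p$ is good for the root system of $G$, (H3) there is a non-degenerate $G$-invariant bilinear form $\kappa$ on $\mathfrak g=\operatorname{Lie}(G)$. The truncated current algebra $\mathfrak g_m=\mathfrak g\otimes\Bbbk[t]/(t^{m+1})$ is a Lie algebra over $\Bbbk$ with bracket $[xt^i,yt^j]=[x,y]t^{i+j}$ where $xt^i:=x\otimes t^i$. An element $x$ of a finite-dimensional Lie algebra $\mathfrak l$ is regular if the dimension of its centraliser $\mathfrak l^x=\{y\in\mathfrak l\mid[y,x]=0\}$ is minimal among all centralisers of elements of $\mathfrak l$. *)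

theory Defs
  imports
    "HOL-Analysis.Determinants"
    "HOL-Computational_Algebra.Polynomial"
    "HOL-Library.Poly_Mapping"
    "HOL-Algebra.Generated_Groups"
begin

section \<open>Finite-dimensional Lie algebras and truncated current algebras\<close>

text \<open>
  A Lie algebra is given by its underlying set inside an ambient abelian group type,
  together with the scalar multiplication and the bracket.
\<close>

record ('a, 'b) lie_structure = "'b partial_object" +
  lie_scale :: "'a \<Rightarrow> 'b \<Rightarrow> 'b"
  lie_bracket :: "'b \<Rightarrow> 'b \<Rightarrow> 'b"

definition lie_centraliser :: "('a, 'b::zero) lie_structure \<Rightarrow> 'b \<Rightarrow> 'b set" where
  "lie_centraliser L x = {y \<in> carrier L. lie_bracket L y x = 0}"

definition lie_regular :: "('a::field, 'b::ab_group_add) lie_structure \<Rightarrow> 'b \<Rightarrow> bool" where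
  "lie_regular L x \<longleftrightarrow> x \<in> carrier L \<and>
     (\<forall>z \<in> carrier L.
        vector_space.dim (lie_scale L) (lie_centraliser L x)
          \<le> vector_space.dim (lie_scale L) (lie_centraliser L z))"

text \<open>
  The element \<open>\<Sum>i\<le>m. x\<^sub>i t\<^sup>i\<close> of \<open>L \<otimes> k[t]/(t\<^sup>m\<^sup>+\<^sup>1)\<close> is represented by the polynomial of degree
  at most \<open>m\<close> with coefficients \<open>x\<^sub>i\<close> in \<open>L\<close>. The type \<open>'b\<close> carries no multiplication
  here; only the additive structure of \<open>'b poly\<close> is used.
\<close>

definition truncated_current ::
    "nat \<Rightarrow> ('a, 'b::ab_group_add) lie_structure \<Rightarrow> ('a, 'b poly) lie_structure" where
  "truncated_current m L =
    \<lparr>carrier = {x. degree x \<le> m \<and> (\<forall>i. coeff x i \<in> carrier L)},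
     lie_scale = (\<lambda>c. map_poly (lie_scale L c)),
     lie_bracket = (\<lambda>x y. \<Sum>i\<le>m. \<Sum>j\<le>m - i. monom (lie_bracket L (coeff x i) (coeff y j)) (i + j))\<rparr>"


section \<open>Linear algebraic groups\<close>

text \<open>
  Throughout, an affine algebraic group is a Zariski closed subgroup of some \<open>GL\<^sub>n(k)\<close>, where
  \<open>n\<close> is the cardinality of the index type \<open>'n\<close>. Polynomials in variables indexed by \<open>'v\<close> are
  finitely supported functions on the monomials \<open>'v \<Rightarrow>\<^sub>0 nat\<close>.
\<close>

definition poly_eval ::
    "(('v \<Rightarrow>\<^sub>0 nat) \<Rightarrow>\<^sub>0 'a::comm_ring_1) \<Rightarrow> ('v \<Rightarrow> 'a) \<Rightarrow> 'a" where
  "poly_eval f a =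
     (\<Sum>\<mu> \<in> Poly_Mapping.keys f. Poly_Mapping.lookup f \<mu> * (\<Prod>v \<in> Poly_Mapping.keys \<mu>. a v ^ Poly_Mapping.lookup \<mu> v))"

text \<open>The formal directional derivative \<open>\<Sum>v. (\<partial>f/\<partial>v)(a) \<cdot> d v\<close>.\<close>

definition poly_differential ::
    "(('v \<Rightarrow>\<^sub>0 nat) \<Rightarrow>\<^sub>0 'a::comm_ring_1) \<Rightarrow> ('v \<Rightarrow> 'a) \<Rightarrow> ('v \<Rightarrow> 'a) \<Rightarrow> 'a" where
  "poly_differential f a d =
     (\<Sum>\<mu> \<in> Poly_Mapping.keys f. Poly_Mapping.lookup f \<mu> *
        (\<Sum>v \<in> Poly_Mapping.keys \<mu>. of_nat (Poly_Mapping.lookup \<mu> v) * a v ^ (Poly_Mapping.lookup \<mu> v - 1)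
            * (\<Prod>w \<in> Poly_Mapping.keys \<mu> - {v}. a w ^ Poly_Mapping.lookup \<mu> w) * d v))"

definition entries :: "'a^'n^'n \<Rightarrow> 'n \<times> 'n \<Rightarrow> 'a" where
  "entries A = (\<lambda>(i, j). A $ i $ j)"

definition GL :: "('a::field^'n^'n) monoid" where
  "GL = \<lparr>carrier = {A. invertible A}, monoid.mult = (**), one = mat 1\<rparr>"

text \<open>The topology of \<open>GL\<^sub>n\<close> is induced from that of the affine space of all matrices.\<close>

definition zariski_closed :: "('a::field^'n^'n) set \<Rightarrow> bool" where
  "zariski_closed Z \<longleftrightarrow>
     (\<exists>S. Z = {A \<in> carrier GL. \<forall>f \<in> S. poly_eval f (entries A) = 0})"

definition zariski_connected :: "('a::field^'n^'n) set \<Rightarrow> bool" where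
  "zariski_connected Z \<longleftrightarrow>
     \<not> (\<exists>A B. zariski_closed A \<and> zariski_closed B \<and> A \<noteq> {} \<and> B \<noteq> {} \<and> A \<inter> B = {} \<and> A \<union> B = Z)"

definition algebraic_group :: "('a::field^'n^'n) set \<Rightarrow> bool" where
  "algebraic_group G \<longleftrightarrow> subgroup G GL \<and> zariski_closed G"

definition regular_function :: "('a::field^'n^'n) set \<Rightarrow> ('a^'n^'n \<Rightarrow> 'a) \<Rightarrow> bool" where
  "regular_function G h \<longleftrightarrow>
     (\<exists>f k. \<forall>A \<in> G. h A = poly_eval f (entries A) / det A ^ k)"

definition mat_scale :: "'a::times \<Rightarrow> 'a^'n^'n \<Rightarrow> 'a^'n^'n" where
  "mat_scale c A = (\<chi> i j. c * A $ i $ j)"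

text \<open>
  \<open>Lie(G)\<close> is the tangent space of \<open>G\<close> at the identity, cut out in the space of all matrices by
  the differentials of all polynomials vanishing on \<open>G\<close>.
\<close>

definition Lie :: "('a::field^'n^'n) set \<Rightarrow> ('a, 'a^'n^'n) lie_structure" where
  "Lie G =
    \<lparr>carrier = {X. \<forall>f. (\<forall>A \<in> G. poly_eval f (entries A) = 0) \<longrightarrow>
                      poly_differential f (entries (mat 1)) (entries X) = 0},
     lie_scale = mat_scale,
     lie_bracket = (\<lambda>X Y. X ** Y - Y ** X)\<rparr>"

definition Ad :: "'a::field^'n^'n \<Rightarrow> 'a^'n^'n \<Rightarrow> 'a^'n^'n" where
  "Ad g X = g ** X ** matrix_inv g"

definition unipotent :: "'a::field^'n^'n \<Rightarrow> bool" where
  "unipotent A \<longleftrightarrow> (\<exists>k. (((**) (A - mat 1)) ^^ k) (mat 1) = 0)"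

text \<open>Reductive: the unipotent radical is trivial.\<close>

definition connected_reductive :: "('a::field^'n^'n) set \<Rightarrow> bool" where
  "connected_reductive G \<longleftrightarrow> algebraic_group G \<and> zariski_connected G \<and>
     (\<forall>U. algebraic_group U \<and> zariski_connected U \<and> (\<forall>u \<in> U. unipotent u)
            \<and> U \<lhd> GL\<lparr>carrier := G\<rparr> \<longrightarrow> U = {mat 1})"


section \<open>Tori, characters and roots\<close>

definition split_torus :: "nat \<Rightarrow> (nat \<Rightarrow> 'a::field) monoid" where
  "split_torus r =
    \<lparr>carrier = {..<r} \<rightarrow>\<^sub>E (- {0}),
     monoid.mult = (\<lambda>a b. \<lambda>i \<in> {..<r}. a i * b i),
     one = (\<lambda>i \<in> {..<r}. 1)\<rparr>"

text \<open>A torus is an algebraic group isomorphic, as an algebraic group, to some \<open>(k\<^sup>*)\<^sup>r\<close>.\<close>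

definition torus :: "('a::field^'n^'n) set \<Rightarrow> bool" where
  "torus T \<longleftrightarrow> algebraic_group T \<and>
     (\<exists>r. \<exists>\<phi> \<in> iso (GL\<lparr>carrier := T\<rparr>) (split_torus r).
        (\<forall>i<r. regular_function T (\<lambda>A. \<phi> A i)) \<and>
        (\<forall>i j. \<exists>f k. \<forall>c \<in> carrier (split_torus r).
            inv_into T \<phi> c $ i $ j = poly_eval f c / (\<Prod>l<r. c l) ^ k))"

definition maximal_torus :: "('a::field^'n^'n) set \<Rightarrow> ('a^'n^'n) set \<Rightarrow> bool" where
  "maximal_torus G T \<longleftrightarrow> torus T \<and> T \<subseteq> G \<and> (\<forall>S. torus S \<and> T \<subseteq> S \<and> S \<subseteq> G \<longrightarrow> S = T)"

text \<open>
  Characters and cocharacters are made extensional outside their domain, so that equality of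
  functions is equality of homomorphisms.
\<close>

definition characters :: "('a::field^'n^'n) set \<Rightarrow> ('a^'n^'n \<Rightarrow> 'a) set" where
  "characters T =
     {\<psi>. \<psi> \<in> T \<rightarrow>\<^sub>E (- {0}) \<and> regular_function T \<psi> \<and> (\<forall>s \<in> T. \<forall>t \<in> T. \<psi> (s ** t) = \<psi> s * \<psi> t)}"

definition cocharacter_group :: "('a::field^'n^'n) set \<Rightarrow> ('a \<Rightarrow> 'a^'n^'n) monoid" where
  "cocharacter_group T =
    \<lparr>carrier = {\<gamma>. \<gamma> \<in> (- {0}) \<rightarrow>\<^sub>E T \<and>
        (\<forall>i j. \<exists>f k. \<forall>c. c \<noteq> 0 \<longrightarrow> \<gamma> c $ i $ j = poly f c / c ^ k) \<and>
        (\<forall>c d. c \<noteq> 0 \<longrightarrow> d \<noteq> 0 \<longrightarrow> \<gamma> (c * d) = \<gamma> c ** \<gamma> d)},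
     monoid.mult = (\<lambda>\<gamma> \<delta>. \<lambda>c \<in> - {0}. \<gamma> c ** \<delta> c),
     one = (\<lambda>c \<in> - {0}. mat 1)\<rparr>"

definition roots :: "('a::field^'n^'n) set \<Rightarrow> ('a^'n^'n) set \<Rightarrow> ('a^'n^'n \<Rightarrow> 'a) set" where
  "roots G T =
     {\<alpha> \<in> characters T. (\<exists>t \<in> T. \<alpha> t \<noteq> 1) \<and>
        (\<exists>X \<in> carrier (Lie G). X \<noteq> 0 \<and> (\<forall>t \<in> T. Ad t X = mat_scale (\<alpha> t) X))}"

text \<open>
  The character group is written multiplicatively, so the integral combination
  \<open>\<Sum>\<delta>\<in>\<Delta>. c \<delta> \<cdot> \<delta>\<close> of characters is the function \<open>t \<mapsto> \<Prod>\<delta>\<in>\<Delta>. \<delta> t powi c \<delta>\<close>.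
\<close>

definition char_combination ::
    "('a::field^'n^'n) set \<Rightarrow> ('a^'n^'n \<Rightarrow> 'a) set \<Rightarrow> (('a^'n^'n \<Rightarrow> 'a) \<Rightarrow> int) \<Rightarrow> 'a^'n^'n \<Rightarrow> 'a" where
  "char_combination T \<Delta> c = (\<lambda>t \<in> T. \<Prod>\<delta> \<in> \<Delta>. \<delta> t powi c \<delta>)"

definition simple_roots ::
    "('a::field^'n^'n) set \<Rightarrow> ('a^'n^'n) set \<Rightarrow> ('a^'n^'n \<Rightarrow> 'a) set \<Rightarrow> bool" where
  "simple_roots G T \<Delta> \<longleftrightarrow> finite \<Delta> \<and> \<Delta> \<subseteq> roots G T \<and>
     (\<forall>c. char_combination T \<Delta> c = (\<lambda>t \<in> T. 1) \<longrightarrow> (\<forall>\<delta> \<in> \<Delta>. c \<delta> = 0)) \<and>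
     (\<forall>\<beta> \<in> roots G T. \<exists>c. \<beta> = char_combination T \<Delta> c \<and>
        ((\<forall>\<delta> \<in> \<Delta>. c \<delta> \<ge> 0) \<or> (\<forall>\<delta> \<in> \<Delta>. c \<delta> \<le> 0)))"

text \<open>
  A prime is good if it divides no non-zero coefficient of a root written in terms of
  simple roots. As maximal tori and systems of simple roots are conjugate, the choice of
  \<open>T\<close> and \<open>\<Delta>\<close> does not matter.
\<close>

definition good_prime :: "nat \<Rightarrow> ('a::field^'n^'n) set \<Rightarrow> bool" where
  "good_prime p G \<longleftrightarrow> prime p \<and>
     (\<forall>T \<Delta> c. maximal_torus G T \<and> simple_roots G T \<Delta> \<and> char_combination T \<Delta> c \<in> roots G T \<longrightarrow>
        (\<forall>\<delta> \<in> \<Delta>. c \<delta> \<noteq> 0 \<longrightarrow> \<not> int p dvd c \<delta>))"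

text \<open>
  The coroot \<open>\<gamma>\<close> of \<open>\<alpha>\<close> is the cocharacter with \<open>\<langle>\<alpha>, \<gamma>\<rangle> = 2\<close> such that the reflection
  \<open>t \<mapsto> t \<cdot> \<gamma>(\<alpha>(t))\<^sup>-\<^sup>1\<close> of \<open>T\<close> is induced by an element \<open>w\<close> of the normaliser of \<open>T\<close>, that is
  \<open>w \<psi> = \<psi> - \<langle>\<psi>, \<gamma>\<rangle> \<alpha>\<close> for all characters \<open>\<psi>\<close> of \<open>T\<close>. Such a \<open>w\<close> automatically centralises
  the kernel of \<open>\<alpha>\<close>.
\<close>

definition coroots :: "('a::field^'n^'n) set \<Rightarrow> ('a^'n^'n) set \<Rightarrow> ('a \<Rightarrow> 'a^'n^'n) set" where
  "coroots G T =
     {\<gamma> \<in> carrier (cocharacter_group T). \<exists>\<alpha> \<in> roots G T.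
        (\<forall>c. c \<noteq> 0 \<longrightarrow> \<alpha> (\<gamma> c) = c ^ 2) \<and>
        (\<exists>w \<in> G. \<forall>t \<in> T. Ad w t = t ** matrix_inv (\<gamma> (\<alpha> t)))}"

text \<open>
  Meant for semisimple groups: the fundamental group, the quotient of the cocharacter lattice
  by the coroot lattice, is trivial.
\<close>

definition simply_connected_semisimple :: "('a::field^'n^'n) set \<Rightarrow> bool" where
  "simply_connected_semisimple G \<longleftrightarrow>
     (\<forall>T. maximal_torus G T \<longrightarrow>
        generate (cocharacter_group T) (coroots G T) = carrier (cocharacter_group T))"


section \<open>Standard reductive groups\<close>

definition invariant_form :: "('a::field^'n^'n) set \<Rightarrow> ('a^'n^'n \<Rightarrow> 'a^'n^'n \<Rightarrow> 'a) \<Rightarrow> bool" where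
  "invariant_form G \<kappa> \<longleftrightarrow>
     (\<forall>X \<in> carrier (Lie G). \<forall>Y \<in> carrier (Lie G). \<forall>Z \<in> carrier (Lie G). \<forall>c.
        \<kappa> (X + Y) Z = \<kappa> X Z + \<kappa> Y Z \<and> \<kappa> Z (X + Y) = \<kappa> Z X + \<kappa> Z Y \<and>
        \<kappa> (mat_scale c X) Y = c * \<kappa> X Y \<and> \<kappa> X (mat_scale c Y) = c * \<kappa> X Y) \<and>
     (\<forall>g \<in> G. \<forall>X \<in> carrier (Lie G). \<forall>Y \<in> carrier (Lie G). \<kappa> (Ad g X) (Ad g Y) = \<kappa> X Y)"

definition nondegenerate_form ::
    "('a::field^'n^'n) set \<Rightarrow> ('a^'n^'n \<Rightarrow> 'a^'n^'n \<Rightarrow> 'a) \<Rightarrow> bool" where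
  "nondegenerate_form G \<kappa> \<longleftrightarrow>
     (\<forall>X \<in> carrier (Lie G). (\<forall>Y \<in> carrier (Lie G). \<kappa> X Y = 0) \<longrightarrow> X = 0) \<and>
     (\<forall>Y \<in> carrier (Lie G). (\<forall>X \<in> carrier (Lie G). \<kappa> X Y = 0) \<longrightarrow> Y = 0)"

definition standard_reductive :: "('a::field^'n^'n) set \<Rightarrow> bool" where
  "standard_reductive G \<longleftrightarrow>
     connected_reductive G \<and>
     simply_connected_semisimple (derived GL G) \<and>
     good_prime CHAR('a) G \<and>
     (\<exists>\<kappa>. invariant_form G \<kappa> \<and> nondegenerate_form G \<kappa>)"

end

theory Submission
  imports Defs
begin

text \<open>
  Write \<open>\<gg>\<close> for the Lie algebra of the group and \<open>\<gg>\<^sub>m\<close> for its truncated current algebra. Let \<open>r\<close>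
  be the minimal dimension of a centraliser in \<open>\<gg>\<close>, and for \<open>x = \<Sum>i\<le>m. x\<^sub>i t\<^sup>i\<close> let \<open>c(x\<^sub>0)\<close> and
  \<open>c\<^sub>m(x)\<close> be the dimensions of the centralisers of \<open>x\<^sub>0\<close> in \<open>\<gg>\<close> and of \<open>x\<close> in \<open>\<gg>\<^sub>m\<close>. Everything
  follows from the two estimates
    \<open>m r + c(x\<^sub>0) \<le> c\<^sub>m(x) \<le> (m + 1) c(x\<^sub>0)\<close>.
  The left one gives \<open>(m + 1) r \<le> c\<^sub>m(x)\<close> for all \<open>x\<close>, and by the right one equality holds whenever
  \<open>x\<^sub>0\<close> is regular; hence \<open>(m + 1) r\<close> is the minimal dimension of a centraliser in \<open>\<gg>\<^sub>m\<close>. By the left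
  one again, equality forces \<open>c(x\<^sub>0) = r\<close>. The estimates are linear algebra: they hold for every
  bilinear product on a finite-dimensional space over an infinite field, and this is the
  generality of the locale \<open>bilinear_product\<close>.

  Dimensions of spaces of polynomials are computed by the \<open>t\<close>-adic filtration: the dimension of
  such a space is the sum over \<open>i\<close> of the dimensions of the spaces of lowest coefficients in
  degree \<open>i\<close> (\<open>dim_eq_sum_lowest\<close>). A lowest coefficient of an element of the centraliser of \<open>x\<close>
  commutes with \<open>x\<^sub>0\<close>, which gives the upper estimate (\<open>dim_current_centraliser_le\<close>).

  For the lower estimate (\<open>dim_current_centraliser_ge\<close>), every element of the centraliser of
  \<open>x\<^sub>0\<close> occurs as a lowest coefficient in degree \<open>m\<close>, because \<open>v t\<^sup>m\<close> commutes with \<open>x\<close> as soon as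
  \<open>v\<close> commutes with \<open>x\<^sub>0\<close>. In every degree below \<open>m\<close>, the lowest coefficients contain the space
  \<open>K\<close> of the values \<open>y(0)\<close> of those \<open>y\<close> in \<open>\<gg>[t]\<close> which commute with \<open>x\<close> exactly, not only modulo
  \<open>t\<^bsup>m+1\<^esup>\<close>. So it remains to see that \<open>K\<close> has dimension at least \<open>r\<close>. Since the centralisers of all
  the elements \<open>x(a)\<close> with \<open>a\<close> a scalar have dimension at least \<open>r\<close>, the generic rank is small
  enough for many polynomial solutions \<open>y\<close> to exist; \<open>generic_centraliser_specialises\<close> makes this
  precise by counting linear conditions on the solutions of bounded degree.
\<close>

section \<open>Algebraically closed fields are infinite\<close>

lemma infinite_alg_closed_field: "infinite (UNIV :: 'a::alg_closed_field set)"
proof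
  assume fin: "finite (UNIV :: 'a set)"
  \<comment> \<open>\<open>p + 1\<close> takes the value \<open>1\<close> at every element of a finite field.\<close>
  define p :: "'a poly" where "p = (\<Prod>a\<in>UNIV. [:- a, 1:])"
  have "degree p = card (UNIV :: 'a set)"
    unfolding p_def by (simp add: degree_prod_eq_sum_degree)
  then have "degree (p + 1) > 0"
    using fin by (simp add: degree_add_eq_left card_gt_0_iff)
  then obtain c where "poly (p + 1) c = 0"
    using alg_closed_imp_poly_has_root by blast
  moreover have "poly p c = 0"
    using fin by (simp add: p_def poly_prod)
  ultimately show False by simp
qed

section \<open>Dimension in finitely spanned subspaces\<close>

text \<open>
  The ambient space of polynomials has infinite dimension. The value of \<open>dim\<close> on a subspace
  without a finite basis is \<open>0\<close>, so monotonicity and the rank-nullity formula need a finite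
  spanning set.
\<close>

definition finitely_spanned :: "('a::field \<Rightarrow> 'b::ab_group_add \<Rightarrow> 'b) \<Rightarrow> 'b set \<Rightarrow> bool" where
  "finitely_spanned s S \<longleftrightarrow> (\<exists>B. finite B \<and> S \<subseteq> module.span s B)"

context
  fixes s :: "'a::field \<Rightarrow> 'b::ab_group_add \<Rightarrow> 'b"
  assumes vector_space: "vector_space s"
begin

interpretation vs: vector_space s by (rule vector_space)

lemma finitely_spanned_subset: "finitely_spanned s T \<Longrightarrow> S \<subseteq> T \<Longrightarrow> finitely_spanned s S"
  unfolding finitely_spanned_def by blast

lemma finitely_spanned_basis_extend:
  assumes "finitely_spanned s S" "B \<subseteq> S" "vs.independent B"
  obtains C where "B \<subseteq> C" "C \<subseteq> S" "vs.independent C" "S \<subseteq> vs.span C" "finite C" "card C = vs.dim S"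
proof -
  obtain D where D: "finite D" "S \<subseteq> vs.span D"
    using assms(1) by (auto simp: finitely_spanned_def)
  obtain C where C: "B \<subseteq> C" "C \<subseteq> S" "vs.independent C" "S \<subseteq> vs.span C"
    using vs.maximal_independent_subset_extend[OF assms(2,3)] .
  then have "finite C" using vs.independent_span_bound[OF D(1) C(3)] D(2) by blast
  with C that vs.basis_card_eq_dim show thesis by blast
qed

lemma dim_mono_finitely_spanned:
  assumes "S \<subseteq> T" "finitely_spanned s T" shows "vs.dim S \<le> vs.dim T"
proof -
  obtain C where "T \<subseteq> vs.span C" "finite C" "card C = vs.dim T"
    using finitely_spanned_basis_extend[OF assms(2) empty_subsetI vs.independent_empty] by metis
  then show ?thesis using vs.dim_le_card[of S C] assms(1) by auto
qed

text \<open>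
  The coordinates of \<open>\<Sum>n\<le>D. c\<^sup>n z\<^sub>n\<close> in a basis are scalar polynomials in \<open>c\<close> of degree at most \<open>D\<close>
  with more than \<open>D\<close> zeros.
\<close>

lemma polynomial_identity:
  assumes "finite C" "card C > D" "\<And>c. c \<in> C \<Longrightarrow> (\<Sum>n\<le>D. s (c ^ n) (z n)) = 0" "n \<le> D"
  shows "z n = 0"
proof -
  obtain B where B: "vs.independent B" "UNIV \<subseteq> vs.span B"
    using vs.maximal_independent_subset[of UNIV] by metis
  have sp: "v \<in> vs.span B" for v using B(2) by auto
  have "vs.representation B (z n) b = 0" for b
  proof -
    define p where "p = (\<Sum>n\<le>D. monom (vs.representation B (z n) b) n)"
    have root: "poly p c = 0" if "c \<in> C" for c
    proof -
      have "poly p c = vs.representation B (\<Sum>n\<le>D. s (c ^ n) (z n)) b"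
        by (simp add: p_def poly_sum poly_monom vs.representation_sum[OF B(1) sp]
            vs.representation_scale[OF B(1) sp] mult.commute)
      then show ?thesis by (simp add: assms(3)[OF that] vs.representation_zero)
    qed
    have "degree p \<le> D" unfolding p_def
      by (rule degree_sum_le) (auto intro: order_trans[OF degree_monom_le])
    have "p = 0"
    proof (rule ccontr)
      assume "p \<noteq> 0"
      then have "card C \<le> card {c. poly p c = 0}"
        using root by (intro card_mono poly_roots_finite) auto
      also have "\<dots> \<le> D"
        using card_poly_roots_bound[OF \<open>p \<noteq> 0\<close>] \<open>degree p \<le> D\<close> by simp
      finally show False using assms(2) by simp
    qed
    then show ?thesis using coeff_sum_monom[OF assms(4), of "\<lambda>n. vs.representation B (z n) b"]
      by (simp add: p_def)
  qed
  then show ?thesis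
    using vs.sum_nonzero_representation_eq[OF B(1) sp, of "z n"] by simp
qed

end

context vector_space_pair begin

lemma finitely_spanned_image:
  assumes "Vector_Spaces.linear s1 s2 f" "finitely_spanned s1 S"
  shows "finitely_spanned s2 (f ` S)"
proof -
  interpret f: Vector_Spaces.linear s1 s2 f by fact
  show ?thesis using assms(2) f.spans_image
    unfolding finitely_spanned_def by (meson finite_imageI)
qed

lemma rank_nullity:
  assumes "Vector_Spaces.linear s1 s2 f" "finitely_spanned s1 S" "vs1.subspace S"
  shows "vs1.dim S = vs2.dim (f ` S) + vs1.dim {x \<in> S. f x = 0}"
proof -
  interpret f: Vector_Spaces.linear s1 s2 f by fact
  let ?K = "{x \<in> S. f x = 0}"
  obtain B where B: "B \<subseteq> ?K" "vs1.independent B" "?K \<subseteq> vs1.span B" "card B = vs1.dim ?K"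
    using vs1.basis_exists .
  then obtain C where C: "B \<subseteq> C" "C \<subseteq> S" "vs1.independent C" "S \<subseteq> vs1.span C" "finite C"
      "card C = vs1.dim S"
    using finitely_spanned_basis_extend[OF vs1.vector_space_axioms assms(2)]
    by (metis (no_types, lifting) mem_Collect_eq subset_iff)
  \<comment> \<open>A kernel vector in the span of \<open>C - B\<close> also lies in the span of \<open>B\<close>; as \<open>C\<close> is independent, it is \<open>0\<close>.\<close>
  have inj: "inj_on f (vs1.span (C - B))"
    unfolding f.inj_on_iff_eq_0[OF vs1.subspace_span]
  proof (intro ballI impI)
    fix x assume x: "x \<in> vs1.span (C - B)" "f x = 0"
    have "vs1.span (C - B) \<subseteq> S"
      using C(2) assms(3) by (intro vs1.span_minimal) auto
    with x B(3) have xB: "x \<in> vs1.span B" by auto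
    have "vs1.representation C x = vs1.representation B x"
      using vs1.representation_extend[OF C(3) xB C(1)] .
    moreover have "vs1.representation C x = vs1.representation (C - B) x"
      using vs1.representation_extend[OF C(3) x(1)] by simp
    ultimately have "vs1.representation (C - B) x b = 0" for b
      using vs1.representation_ne_zero by (metis DiffD2)
    moreover have "vs1.independent (C - B)"
      using C(3) vs1.independent_mono by blast
    ultimately show "x = 0"
      using vs1.sum_nonzero_representation_eq[of "C - B" x] x(1) by simp
  qed
  have "vs2.dim (f ` S) = card (f ` (C - B))"
  proof (rule vs2.basis_card_eq_dim[symmetric])
    show "f ` (C - B) \<subseteq> f ` S" using C(2) by blast
    show "vs2.independent (f ` (C - B))"
      using vs1.independent_mono[OF C(3)] inj by (intro f.independent_injective_image) blast+
    have "f ` C \<subseteq> insert 0 (f ` (C - B))" using B(1) by auto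
    then have "vs2.span (f ` C) \<subseteq> vs2.span (f ` (C - B))"
      using vs2.span_mono vs2.span_insert_0 by metis
    then show "f ` S \<subseteq> vs2.span (f ` (C - B))"
      using f.spans_image[OF C(4)] by blast
  qed
  also have "\<dots> = card (C - B)"
    using inj vs1.span_superset by (meson card_image inj_on_subset)
  also have "\<dots> = card C - card B"
    using C(1,5) by (meson card_Diff_subset finite_subset)
  finally show ?thesis
    using B(4) C(6) card_mono[OF C(5,1)] by simp
qed

text \<open>
  Each of the maps imposes at most \<open>q\<close> linear conditions.
\<close>

lemma dim_common_kernel:
  assumes "finite I" "\<And>i. i \<in> I \<Longrightarrow> Vector_Spaces.linear s1 s2 (f i)"
    and "\<And>i. i \<in> I \<Longrightarrow> vs2.dim (f i ` S) \<le> q" "finitely_spanned s1 S" "vs1.subspace S"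
  shows "vs1.dim S \<le> vs1.dim {x \<in> S. \<forall>i\<in>I. f i x = 0} + card I * q"
  using assms(1-3)
proof (induction I rule: finite_induct)
  case (insert i I)
  let ?K = "{x \<in> S. \<forall>i\<in>I. f i x = 0}"
  interpret f: Vector_Spaces.linear s1 s2 "f i" using insert by auto
  have hom: "module_hom s1 s2 (f j)" if "j \<in> I" for j
    using insert.prems(1)[of j] that by (simp add: module_hom_iff_linear)
  have sub: "vs1.subspace ?K"
    using assms(5) by (auto simp: vs1.subspace_def module_hom.zero[OF hom]
        module_hom.add[OF hom] module_hom.scale[OF hom])
  have fin: "finitely_spanned s1 ?K"
    using assms(4) by (rule finitely_spanned_subset[OF vs1.vector_space_axioms]) auto
  have "vs1.dim ?K = vs2.dim (f i ` ?K) + vs1.dim {x \<in> ?K. f i x = 0}"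
    by (rule rank_nullity[OF _ fin sub]) unfold_locales
  moreover have "vs2.dim (f i ` ?K) \<le> vs2.dim (f i ` S)"
    using finitely_spanned_image[OF _ assms(4)] insert.prems(1)
    by (intro dim_mono_finitely_spanned[OF vs2.vector_space_axioms]) auto
  moreover have "{x \<in> ?K. f i x = 0} = {x \<in> S. \<forall>j\<in>insert i I. f j x = 0}" by auto
  moreover have "vs2.dim (f i ` S) \<le> q"
    using insert.prems(2) by simp
  moreover have "vs1.dim S \<le> vs1.dim ?K + card I * q"
    by (rule insert.IH) (use insert.prems in blast)+
  ultimately show ?case
    using insert.hyps by simp
qed simp

end

section \<open>Polynomials over a space with a bilinear product\<close>

locale bilinear_product = vs: vector_space s
  for s :: "'a::field \<Rightarrow> 'b::ab_group_add \<Rightarrow> 'b" +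
  fixes V :: "'b set" and br :: "'b \<Rightarrow> 'b \<Rightarrow> 'b"
  assumes subspace_V: "vs.subspace V"
    and finitely_spanned_V: "finitely_spanned s V"
    and linear_left: "Vector_Spaces.linear s s (\<lambda>y. br y x)"
    and linear_right: "Vector_Spaces.linear s s (br y)"
    and infinite_scalars: "infinite (UNIV :: 'a set)"
begin

lemma br_add_left: "br (y + y') x = br y x + br y' x"
  and br_scale_left: "br (s c y) x = s c (br y x)"
  and br_zero_left: "br 0 x = 0"
proof -
  interpret l: Vector_Spaces.linear s s "\<lambda>y. br y x" by (rule linear_left)
  show "br (y + y') x = br y x + br y' x" "br (s c y) x = s c (br y x)" "br 0 x = 0"
    by (rule l.add, rule l.scale, rule l.zero)
qed

lemma br_sum_left: "br (sum f A) x = (\<Sum>i\<in>A. br (f i) x)"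
  by (induction A rule: infinite_finite_induct) (simp_all add: br_zero_left br_add_left)

lemma br_scale_right: "br y (s c x) = s c (br y x)"
  and br_zero_right: "br y 0 = 0"
  and br_sum_right: "br y (sum f A) = (\<Sum>i\<in>A. br y (f i))"
proof -
  interpret l: Vector_Spaces.linear s s "br y" by (rule linear_right)
  show "br y (s c x) = s c (br y x)" "br y 0 = 0" "br y (sum f A) = (\<Sum>i\<in>A. br y (f i))"
    by (rule l.scale, rule l.zero, rule l.sum)
qed

text \<open>
  The coefficients are vectors, without a multiplication, so scalar multiples of polynomials are
  taken coefficientwise.
\<close>

abbreviation ps :: "'a \<Rightarrow> 'b poly \<Rightarrow> 'b poly" where
  "ps c \<equiv> map_poly (s c)"

lemma coeff_ps [simp]: "coeff (ps c y) i = s c (coeff y i)"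
  by (simp add: coeff_map_poly)

sublocale pv: vector_space ps
  by unfold_locales
    (simp_all add: poly_eq_iff vs.scale_right_distrib vs.scale_left_distrib)

lemma linear_coeff: "Vector_Spaces.linear ps s (\<lambda>y. coeff y i)"
  by (simp add: Vector_Spaces.linear_iff vs.vector_space_axioms pv.vector_space_axioms)

lemma linear_monom: "Vector_Spaces.linear s ps (\<lambda>v. monom v i)"
  by (simp add: Vector_Spaces.linear_iff vs.vector_space_axioms pv.vector_space_axioms
      add_monom poly_eq_iff)

definition polys :: "'b poly set" where
  "polys = {y. \<forall>i. coeff y i \<in> V}"

definition polys_upto :: "nat \<Rightarrow> 'b poly set" where
  "polys_upto d = {y \<in> polys. degree y \<le> d}"

lemma V_closed: "0 \<in> V" "v \<in> V \<Longrightarrow> w \<in> V \<Longrightarrow> v + w \<in> V" "v \<in> V \<Longrightarrow> s c v \<in> V"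
  using subspace_V by (auto simp: vs.subspace_def)

lemma subspace_polys_upto: "pv.subspace (polys_upto d)"
proof -
  have "degree (ps c y) \<le> d" if "degree y \<le> d" for c y
    using that by (intro degree_le) (simp add: coeff_eq_0)
  then show ?thesis
    by (auto simp: pv.subspace_def polys_upto_def polys_def V_closed degree_add_le)
qed

definition truncation :: "(nat \<Rightarrow> 'b) \<Rightarrow> nat \<Rightarrow> 'b poly" where
  "truncation f d = (\<Sum>i\<le>d. monom (f i) i)"

lemma coeff_truncation: "coeff (truncation f d) i = (if i \<le> d then f i else 0)"
  by (auto simp: truncation_def coeff_sum_monom) (simp add: coeff_sum)

lemma truncation_in_polys_upto: "(\<And>i. i \<le> d \<Longrightarrow> f i \<in> V) \<Longrightarrow> truncation f d \<in> polys_upto d"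
  by (auto simp: polys_upto_def polys_def coeff_truncation V_closed intro!: degree_le)

lemma finitely_spanned_polys_upto: "finitely_spanned ps (polys_upto d)"
proof -
  obtain B where B: "finite B" "V \<subseteq> vs.span B"
    using finitely_spanned_V by (auto simp: finitely_spanned_def)
  let ?M = "\<Union>i\<le>d. (\<lambda>v. monom v i) ` B"
  have monom: "monom v i \<in> pv.span ?M" if "v \<in> V" "i \<le> d" for v i
  proof -
    interpret l: Vector_Spaces.linear s ps "\<lambda>v. monom v i" by (rule linear_monom)
    have "monom v i \<in> pv.span ((\<lambda>v. monom v i) ` B)"
      using l.spans_image[OF B(2)] that by blast
    also have "\<dots> \<subseteq> pv.span ?M" using that by (intro pv.span_mono) auto
    finally show ?thesis .
  qed
  have "y \<in> pv.span ?M" if "y \<in> polys_upto d" for y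
  proof -
    have "y = truncation (coeff y) d"
      using that by (auto simp: poly_eq_iff coeff_truncation polys_upto_def coeff_eq_0)
    moreover have "truncation (coeff y) d \<in> pv.span ?M" unfolding truncation_def
      using that by (intro pv.span_sum monom) (auto simp: polys_upto_def polys_def)
    ultimately show ?thesis by simp
  qed
  then show ?thesis unfolding finitely_spanned_def using B(1) by (intro exI[of _ ?M]) auto
qed

section \<open>The filtration by the order of vanishing\<close>

definition lowest :: "nat \<Rightarrow> 'b poly set \<Rightarrow> 'b set" where
  "lowest i S = (\<lambda>y. coeff y i) ` {y \<in> S. \<forall>j<i. coeff y j = 0}"

text \<open>
  The polynomials in \<open>S\<close> divisible by \<open>t\<^sup>n\<close> form a decreasing filtration, and its \<open>n\<close>-th graded
  piece is isomorphic to \<open>lowest n S\<close> through the coefficient in degree \<open>n\<close>.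
\<close>

lemma dim_eq_sum_lowest:
  assumes S: "pv.subspace S" "S \<subseteq> polys_upto d"
  shows "pv.dim S = (\<Sum>i\<le>d. vs.dim (lowest i S))"
proof -
  let ?F = "\<lambda>n. {y \<in> S. \<forall>j<n. coeff y j = 0}"
  interpret cf: vector_space_pair ps s by unfold_locales
  have sub: "pv.subspace (?F n)" for n
    using S(1) by (auto simp: pv.subspace_def)
  have fin: "finitely_spanned ps (?F n)" for n
    by (rule finitely_spanned_subset[OF pv.vector_space_axioms finitely_spanned_polys_upto[of d]])
      (use S(2) in auto)
  have step: "pv.dim (?F n) = vs.dim (lowest n S) + pv.dim (?F (Suc n))" for n
  proof -
    have "pv.dim (?F n) = vs.dim (lowest n S) + pv.dim {y \<in> ?F n. coeff y n = 0}"
      unfolding lowest_def by (rule cf.rank_nullity[OF linear_coeff fin sub])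
    also have "{y \<in> ?F n. coeff y n = 0} = ?F (Suc n)"
      by (auto simp: less_Suc_eq)
    finally show ?thesis .
  qed
  have "pv.dim S = (\<Sum>i<n. vs.dim (lowest i S)) + pv.dim (?F n)" for n
  proof (induction n)
    case (Suc n)
    then show ?case using step[of n] by simp
  qed simp
  from this[of "Suc d"] have "pv.dim S = (\<Sum>i\<le>d. vs.dim (lowest i S)) + pv.dim (?F (Suc d))"
    by (simp only: lessThan_Suc_atMost)
  moreover have "?F (Suc d) \<subseteq> {0}"
  proof clarify
    fix y assume y: "y \<in> S" "\<forall>j<Suc d. coeff y j = 0"
    then have "degree y \<le> d" using S(2) by (auto simp: polys_upto_def)
    then show "y = 0" using y(2)
      by (intro poly_eqI) (metis coeff_0 coeff_eq_0 le_less_trans not_less_eq)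
  qed
  then have "pv.dim (?F (Suc d)) = 0"
    using pv.dim_le_card[of "?F (Suc d)" "{}"] by simp
  ultimately show ?thesis by simp
qed

lemma dim_mono_V:
  assumes "S \<subseteq> T" "T \<subseteq> V" shows "vs.dim S \<le> vs.dim T"
  using finitely_spanned_subset[OF vs.vector_space_axioms finitely_spanned_V assms(2)]
  by (rule dim_mono_finitely_spanned[OF vs.vector_space_axioms assms(1)])

lemma dim_le_if_lowest_subset:
  assumes "pv.subspace S" "S \<subseteq> polys_upto d"
    and "\<And>i. i \<le> d \<Longrightarrow> lowest i S \<subseteq> W" "W \<subseteq> V"
  shows "pv.dim S \<le> Suc d * vs.dim W"
proof -
  have "(\<Sum>i\<le>d. vs.dim (lowest i S)) \<le> of_nat (card {..d}) * vs.dim W"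
    by (rule sum_bounded_above) (rule dim_mono_V[OF assms(3,4)], simp)
  then show ?thesis
    unfolding dim_eq_sum_lowest[OF assms(1,2)] by simp
qed

section \<open>Centralisers of polynomials\<close>

text \<open>
  The coefficient in degree \<open>n\<close> of the product of \<open>y\<close> and \<open>x\<close> in the polynomial current algebra.
\<close>

definition conv :: "'b poly \<Rightarrow> 'b poly \<Rightarrow> nat \<Rightarrow> 'b" where
  "conv y x n = (\<Sum>i\<le>n. br (coeff y i) (coeff x (n - i)))"

lemma linear_conv: "Vector_Spaces.linear ps s (\<lambda>y. conv y x n)"
  by (simp add: Vector_Spaces.linear_iff vs.vector_space_axioms pv.vector_space_axioms conv_def
      br_add_left br_scale_left sum.distrib vs.scale_sum_right)

text \<open>
  Division of \<open>y\<close> by \<open>t\<^sup>i\<close>. Only the coefficients of \<open>z\<close> up to degree \<open>n\<close> are prescribed, so that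
  the lemma covers truncated polynomials as well.
\<close>

lemma conv_shift:
  assumes "\<And>j. j < i \<Longrightarrow> coeff y j = 0" "\<And>j. j \<le> n \<Longrightarrow> coeff z j = coeff y (i + j)"
  shows "conv y x (i + n) = conv z x n"
proof -
  have "conv y x (i + n) = (\<Sum>j\<in>{i..i + n}. br (coeff y j) (coeff x (i + n - j)))"
    unfolding conv_def by (rule sum.mono_neutral_right) (auto simp: assms(1) br_zero_left)
  also have "\<dots> = (\<Sum>j\<le>n. br (coeff y (j + i)) (coeff x (n - j)))"
    by (rule sum.reindex_bij_witness[of _ "\<lambda>j. j + i" "\<lambda>j. j - i"])
      (auto simp: add.commute)
  also have "\<dots> = conv z x n"
    unfolding conv_def by (rule sum.cong) (auto simp: assms(2) add.commute)
  finally show ?thesis .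
qed

definition centraliser :: "'b \<Rightarrow> 'b set" where
  "centraliser v = {y \<in> V. br y v = 0}"

definition current_centraliser :: "nat \<Rightarrow> 'b poly \<Rightarrow> 'b poly set" where
  "current_centraliser m x = {y \<in> polys_upto m. \<forall>n\<le>m. conv y x n = 0}"

definition poly_centraliser :: "'b poly \<Rightarrow> 'b poly set" where
  "poly_centraliser x = {y \<in> polys. \<forall>n. conv y x n = 0}"

lemma subspace_conv_kernel:
  "pv.subspace {y \<in> polys_upto d. \<forall>n. P n \<longrightarrow> conv y x n = 0}"
proof -
  have "module_hom ps s (\<lambda>y. conv y x n)" for n
    using linear_conv module_hom_iff_linear by blast
  from module_hom.zero[OF this] module_hom.add[OF this] module_hom.scale[OF this] show ?thesis
    using subspace_polys_upto unfolding pv.subspace_def by auto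
qed

lemma centraliser_subset: "centraliser v \<subseteq> V"
  by (auto simp: centraliser_def)

lemma subspace_current_centraliser: "pv.subspace (current_centraliser m x)"
  unfolding current_centraliser_def by (rule subspace_conv_kernel)

lemma current_centraliser_subset: "current_centraliser m x \<subseteq> polys_upto m"
  by (auto simp: current_centraliser_def)

text \<open>
  If \<open>y = v t\<^sup>i + \<dots>\<close> commutes with \<open>x\<close> modulo \<open>t\<^bsup>m+1\<^esup>\<close> and \<open>i \<le> m\<close>, then the coefficient in degree
  \<open>i\<close> says that \<open>v\<close> commutes with \<open>x\<^sub>0\<close>.
\<close>

lemma dim_current_centraliser_le:
  "pv.dim (current_centraliser m x) \<le> Suc m * vs.dim (centraliser (coeff x 0))"
proof (rule dim_le_if_lowest_subset[OF subspace_current_centraliser current_centraliser_subset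
      _ centraliser_subset], rule subsetI)
  fix i v
  assume i: "i \<le> m" and "v \<in> lowest i (current_centraliser m x)"
  then obtain y where y: "y \<in> polys_upto m" "\<And>n. n \<le> m \<Longrightarrow> conv y x n = 0"
      "\<And>j. j < i \<Longrightarrow> coeff y j = 0" "v = coeff y i"
    by (auto simp: lowest_def current_centraliser_def)
  have "conv y x (i + 0) = conv [:v:] x 0"
    by (rule conv_shift) (auto simp: y)
  then show "v \<in> centraliser (coeff x 0)"
    using y(1,2,4) i by (simp add: conv_def centraliser_def polys_upto_def polys_def)
qed

section \<open>Specialisation of generic centralisers\<close>

text \<open>
  Evaluation at \<open>c\<close> of a polynomial of degree at most \<open>d\<close>; the fixed bound makes it visibly
  linear on all polynomials.
\<close>

definition value_at :: "nat \<Rightarrow> 'a \<Rightarrow> 'b poly \<Rightarrow> 'b" where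
  "value_at d c y = (\<Sum>i\<le>d. s (c ^ i) (coeff y i))"

lemma linear_value_at: "Vector_Spaces.linear ps s (value_at d c)"
  by (simp add: Vector_Spaces.linear_iff vs.vector_space_axioms pv.vector_space_axioms value_at_def
      vs.scale_right_distrib sum.distrib vs.scale_sum_right mult.commute)

lemma value_at_in_V: "y \<in> polys \<Longrightarrow> value_at d c y \<in> V"
  unfolding value_at_def by (intro vs.subspace_sum subspace_V) (auto simp: polys_def V_closed)

lemma br_coeff_eq_0:
  assumes "degree y \<le> d" "degree x \<le> m" "\<not> (i \<le> d \<and> j \<le> m)"
  shows "br (coeff y i) (coeff x j) = 0"
  using assms by (cases "i \<le> d") (simp_all add: coeff_eq_0 br_zero_left br_zero_right)

lemma conv_eq_0:
  assumes "degree y \<le> d" "degree x \<le> m" "d + m < n"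
  shows "conv y x n = 0"
  unfolding conv_def
  by (rule sum.neutral) (use assms in \<open>auto intro!: br_coeff_eq_0[OF assms(1,2)]\<close>)

lemma br_value_at:
  assumes "degree y \<le> d" "degree x \<le> m"
  shows "br (value_at d c y) (value_at m c x) = (\<Sum>n\<le>d + m. s (c ^ n) (conv y x n))"
proof -
  let ?g = "\<lambda>i j. s (c ^ (i + j)) (br (coeff y i) (coeff x j))"
  have "br (value_at d c y) (value_at m c x) = (\<Sum>i\<le>d. s (c ^ i) (br (coeff y i) (value_at m c x)))"
    unfolding value_at_def[of d] br_sum_left br_scale_left ..
  also have "\<dots> = (\<Sum>(i, j)\<in>{..d} \<times> {..m}. ?g i j)"
    by (simp add: value_at_def br_sum_right br_scale_right power_add vs.scale_sum_right
        sum.cartesian_product)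
  also have "\<dots> = (\<Sum>(i, j)\<in>{(i, j). i + j \<le> d + m}. ?g i j)"
  proof (rule sum.mono_neutral_left)
    show "finite {(i, j). i + j \<le> d + m}"
      by (rule finite_subset[of _ "{..d + m} \<times> {..d + m}"]) auto
    show "\<forall>z\<in>{(i, j). i + j \<le> d + m} - {..d} \<times> {..m}. (case z of (i, j) \<Rightarrow> ?g i j) = 0"
    proof
      fix z assume z: "z \<in> {(i, j). i + j \<le> d + m} - {..d} \<times> {..m}"
      obtain i j where ij: "z = (i, j)" by (cases z)
      with z have "br (coeff y i) (coeff x j) = 0"
        by (intro br_coeff_eq_0[OF assms]) auto
      then show "(case z of (i, j) \<Rightarrow> ?g i j) = 0" by (simp add: ij)
    qed
  qed auto
  also have "\<dots> = (\<Sum>n\<le>d + m. \<Sum>i\<le>n. ?g i (n - i))"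
    by (rule sum.triangle_reindex_eq)
  also have "\<dots> = (\<Sum>n\<le>d + m. s (c ^ n) (conv y x n))"
    by (simp add: conv_def vs.scale_sum_right)
  finally show ?thesis .
qed

lemma dim_polys_upto: "pv.dim (polys_upto d) = Suc d * vs.dim V"
proof -
  have "lowest i (polys_upto d) = V" if "i \<le> d" for i
  proof
    show "lowest i (polys_upto d) \<subseteq> V"
      by (auto simp: lowest_def polys_upto_def polys_def)
    show "V \<subseteq> lowest i (polys_upto d)"
    proof
      fix v assume "v \<in> V"
      then have "monom v i \<in> polys_upto d"
        using that degree_monom_le[of v i]
        by (auto simp: polys_upto_def polys_def V_closed)
      then show "v \<in> lowest i (polys_upto d)"
        unfolding lowest_def by (intro image_eqI[of _ _ "monom v i"]) auto
    qed
  qed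
  then show ?thesis
    using dim_eq_sum_lowest[OF subspace_polys_upto order_refl, of d] by simp
qed

text \<open>
  If \<open>t\<^sup>i z\<close> commutes with \<open>x\<close> in the polynomial current algebra, so does \<open>z\<close>: the centraliser
  is a saturated submodule.
\<close>

lemma lowest_poly_centraliser:
  "lowest i (poly_centraliser x) \<subseteq> (\<lambda>y. coeff y 0) ` poly_centraliser x"
proof
  fix v assume "v \<in> lowest i (poly_centraliser x)"
  then obtain y where y: "y \<in> polys" "\<And>n. conv y x n = 0" "\<And>j. j < i \<Longrightarrow> coeff y j = 0" "v = coeff y i"
    by (auto simp: lowest_def poly_centraliser_def)
  have "conv (poly_shift i y) x n = conv y x (i + n)" for n
    by (rule conv_shift[symmetric]) (auto simp: y coeff_poly_shift add.commute)
  then have "poly_shift i y \<in> poly_centraliser x"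
    using y by (auto simp: poly_centraliser_def polys_def coeff_poly_shift)
  then show "v \<in> (\<lambda>y. coeff y 0) ` poly_centraliser x"
    by (rule rev_image_eqI) (simp add: y coeff_poly_shift)
qed

text \<open>
  Let \<open>N\<close> be the dimension of \<open>V\<close> and \<open>m\<close> the degree of \<open>x\<close>. A polynomial \<open>y\<close> of degree at most
  \<open>d\<close> commutes with \<open>x\<close> once \<open>y(c)\<close> commutes with \<open>x(c)\<close> for \<open>d + m + 1\<close> scalars \<open>c\<close>, as the
  product has degree at most \<open>d + m\<close>. Each scalar imposes at most \<open>N - r\<close> conditions, so the space
  of these \<open>y\<close> has dimension at least
    \<open>(d + 1) N - (d + m + 1) (N - r) = (d + 1) r - m (N - r)\<close>.
  On the other hand its lowest coefficients lie in the space \<open>K\<close> of the conclusion, so that its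
  dimension is at most \<open>d + 1\<close> times that of \<open>K\<close>. Since the correction \<open>m (N - r)\<close> does not grow
  with \<open>d\<close>, this forces \<open>K\<close> to have dimension at least \<open>r\<close>.
\<close>

lemma generic_centraliser_specialises:
  assumes r: "\<And>v. v \<in> V \<Longrightarrow> r \<le> vs.dim (centraliser v)"
    and x: "x \<in> polys"
  shows "r \<le> vs.dim ((\<lambda>y. coeff y 0) ` poly_centraliser x)" (is "_ \<le> vs.dim ?K")
proof (rule ccontr)
  assume less: "\<not> r \<le> vs.dim ?K"
  define N where "N = vs.dim V"
  define m where "m = degree x"
  \<comment> \<open>The smallest degree for which the correction is less than \<open>d + 1\<close>.\<close>
  define d where "d = m * (N - r)"
  interpret cf: vector_space_pair ps s by unfold_locales
  interpret sf: vector_space_pair s s by unfold_locales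
  obtain C :: "'a set" where C: "finite C" "card C = Suc (d + m)"
    using infinite_arbitrarily_large[OF infinite_scalars] by blast
  let ?f = "\<lambda>c y. br (value_at d c y) (value_at m c x)"
  let ?Z = "{y \<in> polys_upto d. \<forall>n. conv y x n = 0}"
  have rank: "vs.dim (?f c ` polys_upto d) \<le> N - r" for c
  proof -
    let ?v = "value_at m c x"
    have "N = vs.dim ((\<lambda>y. br y ?v) ` V) + vs.dim (centraliser ?v)"
      unfolding N_def centraliser_def
      by (rule sf.rank_nullity[OF linear_left finitely_spanned_V subspace_V])
    moreover have "r \<le> vs.dim (centraliser ?v)"
      by (intro r value_at_in_V x)
    moreover have "vs.dim (?f c ` polys_upto d) \<le> vs.dim ((\<lambda>y. br y ?v) ` V)"
      by (rule dim_mono_finitely_spanned[OF vs.vector_space_axioms _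
            sf.finitely_spanned_image[OF linear_left finitely_spanned_V]])
        (auto simp: polys_upto_def value_at_in_V)
    ultimately show ?thesis by linarith
  qed
  have lin: "Vector_Spaces.linear ps s (?f c)" for c
    using Vector_Spaces.linear_compose[OF linear_value_at linear_left, unfolded o_def] .
  have "{y \<in> polys_upto d. \<forall>c\<in>C. ?f c y = 0} \<subseteq> ?Z"
  proof (rule subsetI)
    fix y assume "y \<in> {y \<in> polys_upto d. \<forall>c\<in>C. ?f c y = 0}"
    then have y: "y \<in> polys_upto d" "\<And>c. c \<in> C \<Longrightarrow> ?f c y = 0" by auto
    then have deg: "degree y \<le> d" by (simp add: polys_upto_def)
    have "conv y x n = 0" for n
    proof (cases "n \<le> d + m")
      case True
      show ?thesis
      proof (rule polynomial_identity[OF vs.vector_space_axioms C(1) _ _ True, of "conv y x"])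
        show "(\<Sum>n\<le>d + m. s (c ^ n) (conv y x n)) = 0" if "c \<in> C" for c
          using y(2)[OF that] br_value_at[OF deg, of x m c] by (simp add: m_def)
      qed (simp add: C(2))
    next
      case False
      then show ?thesis by (intro conv_eq_0[OF deg, of x m]) (simp_all add: m_def)
    qed
    then show "y \<in> ?Z" using y(1) by blast
  qed
  then have "pv.dim {y \<in> polys_upto d. \<forall>c\<in>C. ?f c y = 0} \<le> pv.dim ?Z"
    by (rule dim_mono_finitely_spanned[OF pv.vector_space_axioms])
      (rule finitely_spanned_subset[OF pv.vector_space_axioms finitely_spanned_polys_upto], blast)
  moreover have "pv.dim (polys_upto d) \<le> pv.dim {y \<in> polys_upto d. \<forall>c\<in>C. ?f c y = 0} + card C * (N - r)"
    by (rule cf.dim_common_kernel[OF C(1) lin rank finitely_spanned_polys_upto subspace_polys_upto])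
  moreover have "pv.dim ?Z \<le> Suc d * vs.dim ?K"
  proof (rule dim_le_if_lowest_subset)
    show "pv.subspace ?Z" using subspace_conv_kernel[of d "\<lambda>_. True" x] by simp
    have "lowest i ?Z \<subseteq> lowest i (poly_centraliser x)" for i
      by (auto simp: lowest_def poly_centraliser_def polys_upto_def)
    then show "lowest i ?Z \<subseteq> ?K" for i
      using lowest_poly_centraliser by (rule subset_trans)
    show "?K \<subseteq> V" by (auto simp: poly_centraliser_def polys_def)
  qed auto
  ultimately have count: "Suc d * N \<le> Suc d * vs.dim ?K + Suc (d + m) * (N - r)"
    unfolding dim_polys_upto N_def C(2) by linarith
  have "r \<le> N"
    using r[OF V_closed(1)] dim_mono_V[OF centraliser_subset order_refl, of 0]
    unfolding N_def by linarith
  then obtain q where q: "N = r + q" using le_Suc_ex by blast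
  have "Suc d * r + Suc d * q \<le> Suc d * vs.dim ?K + Suc d * q + m * q"
    using count unfolding q by (simp only: add_mult_distrib add_mult_distrib2 add_Suc[symmetric]
        diff_add_inverse add.assoc)
  then have "Suc d * r \<le> Suc d * vs.dim ?K + d"
    unfolding d_def q diff_add_inverse by linarith
  moreover have "Suc d * Suc (vs.dim ?K) \<le> Suc d * r"
    using less by (intro mult_le_mono order_refl) simp
  ultimately show False unfolding mult_Suc_right by linarith
qed

section \<open>Minimal centralisers in the truncated current algebra\<close>

lemma dim_current_centraliser_ge:
  assumes r: "\<And>v. v \<in> V \<Longrightarrow> r \<le> vs.dim (centraliser v)"
    and x: "x \<in> polys"
  shows "m * r + vs.dim (centraliser (coeff x 0)) \<le> pv.dim (current_centraliser m x)"
proof -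
  let ?S = "current_centraliser m x"
  have low: "lowest i ?S \<subseteq> V" for i
    by (auto simp: lowest_def current_centraliser_def polys_upto_def polys_def)
  \<comment> \<open>\<open>t\<^sup>i z\<close> needs to commute with \<open>x\<close> only modulo \<open>t\<^bsup>m+1\<^esup>\<close>, so \<open>z\<close> only modulo \<open>t\<^bsup>m+1-i\<^esup>\<close>.\<close>
  have lift: "coeff z 0 \<in> lowest i ?S"
    if z: "z \<in> polys" "\<And>n. n + i \<le> m \<Longrightarrow> conv z x n = 0" and i: "i \<le> m" for i z
  proof -
    define y where "y = truncation (\<lambda>j. if j < i then 0 else coeff z (j - i)) m"
    have coeff_y: "coeff y j = (if j < i \<or> j > m then 0 else coeff z (j - i))" for j
      by (simp add: y_def coeff_truncation)
    have "conv y x n = 0" if "n \<le> m" for n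
    proof (cases "n < i")
      case True
      then show ?thesis by (simp add: conv_def coeff_y br_zero_left)
    next
      case False
      then obtain k where k: "n = i + k" using le_Suc_ex not_less by blast
      have "conv y x (i + k) = conv z x k"
        using that k by (intro conv_shift) (auto simp: coeff_y)
      then show ?thesis using z(2)[of k] that k by simp
    qed
    moreover have "y \<in> polys_upto m"
      unfolding y_def using z(1) by (intro truncation_in_polys_upto) (auto simp: polys_def V_closed)
    ultimately have "y \<in> ?S" by (simp add: current_centraliser_def)
    then show ?thesis
      unfolding lowest_def by (intro image_eqI[of _ _ y]) (use i in \<open>auto simp: coeff_y\<close>)
  qed
  have "r \<le> vs.dim (lowest i ?S)" if "i < m" for i
  proof -
    have "(\<lambda>y. coeff y 0) ` poly_centraliser x \<subseteq> lowest i ?S"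
      using that lift by (auto simp: poly_centraliser_def)
    then show ?thesis
      using generic_centraliser_specialises[OF r x] dim_mono_V[OF _ low] by (meson order_trans)
  qed
  then have "m * r \<le> (\<Sum>i<m. vs.dim (lowest i ?S))"
    using sum_bounded_below[of "{..<m}" r "\<lambda>i. vs.dim (lowest i ?S)"] by simp
  moreover have "vs.dim (centraliser (coeff x 0)) \<le> vs.dim (lowest m ?S)"
  proof (rule dim_mono_V[OF _ low], rule subsetI)
    fix v assume v: "v \<in> centraliser (coeff x 0)"
    then have "coeff [:v:] 0 \<in> lowest m ?S"
      by (intro lift) (auto simp: polys_def centraliser_def conv_def coeff_pCons V_closed split: nat.split)
    then show "v \<in> lowest m ?S" by simp
  qed
  moreover have "pv.dim ?S = (\<Sum>i<m. vs.dim (lowest i ?S)) + vs.dim (lowest m ?S)"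
    unfolding dim_eq_sum_lowest[OF subspace_current_centraliser current_centraliser_subset]
    by (simp only: lessThan_Suc_atMost[symmetric] sum.lessThan_Suc)
  ultimately show ?thesis by linarith
qed

theorem minimal_centraliser_iff:
  assumes x: "x \<in> polys_upto m"
  shows "(\<forall>v\<in>V. vs.dim (centraliser (coeff x 0)) \<le> vs.dim (centraliser v)) \<longleftrightarrow>
    (\<forall>z\<in>polys_upto m. pv.dim (current_centraliser m x) \<le> pv.dim (current_centraliser m z))"
    (is "?L \<longleftrightarrow> ?R")
proof
  have xV: "coeff x 0 \<in> V" and xp: "x \<in> polys"
    using x by (auto simp: polys_upto_def polys_def)
  have "\<exists>w. w \<in> V" using V_closed(1) by blast
  then obtain w where w: "w \<in> V" "\<And>v. v \<in> V \<Longrightarrow> vs.dim (centraliser w) \<le> vs.dim (centraliser v)"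
    using exists_least_iff[of "\<lambda>n. \<exists>w\<in>V. vs.dim (centraliser w) = n"] by (metis not_le)
  define r where "r = vs.dim (centraliser w)"
  note ge = dim_current_centraliser_ge[OF w(2), folded r_def]
  {
    assume ?L
    then have eq: "vs.dim (centraliser (coeff x 0)) = r"
      using w xV by (simp add: r_def order_antisym)
    show ?R
    proof
      fix z assume z: "z \<in> polys_upto m"
      have "r \<le> vs.dim (centraliser (coeff z 0))"
        using z by (auto simp: r_def polys_upto_def polys_def intro!: w(2))
      then show "pv.dim (current_centraliser m x) \<le> pv.dim (current_centraliser m z)"
        using dim_current_centraliser_le[of m x] ge[of z m] z
        by (simp add: eq polys_upto_def)
    qed
  }
  {
    assume ?R
    moreover have "[:w:] \<in> polys_upto m"
      using w(1) by (auto simp: polys_upto_def polys_def coeff_pCons V_closed split: nat.split)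
    ultimately have "pv.dim (current_centraliser m x) \<le> Suc m * r"
      using dim_current_centraliser_le[of m "[:w:]"] by (force simp: r_def)
    then have "vs.dim (centraliser (coeff x 0)) \<le> r"
      using ge[of x m] xp by simp
    then show ?L using w(2) by (force simp: r_def)
  }
qed

end

text \<open>
  The double sum defining the bracket of the truncated current algebra is the truncation of the
  product \<open>conv\<close>; with this, \<open>minimal_centraliser_iff\<close> becomes a statement about regular elements.
\<close>

theorem lie_regular_truncated_current_iff:
  fixes L :: "('a::field, 'b::ab_group_add) lie_structure"
  assumes L: "bilinear_product (lie_scale L) (carrier L) (lie_bracket L)"
    and x: "x \<in> carrier (truncated_current m L)"
  shows "lie_regular L (coeff x 0) \<longleftrightarrow> lie_regular (truncated_current m L) x"
proof -
  interpret bilinear_product "lie_scale L" "carrier L" "lie_bracket L" by (rule L)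
  have carrier: "carrier (truncated_current m L) = polys_upto m"
    by (auto simp: truncated_current_def polys_upto_def polys_def)
  have scale: "lie_scale (truncated_current m L) = ps"
    by (simp add: truncated_current_def)
  have coeff_bracket: "coeff (lie_bracket (truncated_current m L) y z) n = (if n \<le> m then conv y z n else 0)"
    for y z n
  proof -
    have "coeff (lie_bracket (truncated_current m L) y z) n =
        (\<Sum>i\<le>m. \<Sum>j\<le>m - i. if i + j = n then lie_bracket L (coeff y i) (coeff z j) else 0)"
      by (simp add: truncated_current_def coeff_sum)
    also have "\<dots> = (\<Sum>i\<le>m. if i \<le> n \<and> n \<le> m then lie_bracket L (coeff y i) (coeff z (n - i)) else 0)"
    proof (rule sum.cong[OF refl])
      fix i assume i: "i \<in> {..m}"
      have "(\<Sum>j\<le>m - i. if i + j = n then lie_bracket L (coeff y i) (coeff z j) else 0) =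
        (\<Sum>j\<le>m - i. if j = n - i \<and> i \<le> n then lie_bracket L (coeff y i) (coeff z j) else 0)"
        by (rule sum.cong) auto
      also have "\<dots> = (if i \<le> n \<and> n \<le> m then lie_bracket L (coeff y i) (coeff z (n - i)) else 0)"
        using i by (cases "i \<le> n") (auto simp: sum.delta)
      finally show "(\<Sum>j\<le>m - i. if i + j = n then lie_bracket L (coeff y i) (coeff z j) else 0) =
        (if i \<le> n \<and> n \<le> m then lie_bracket L (coeff y i) (coeff z (n - i)) else 0)" .
    qed
    also have "\<dots> = (if n \<le> m then conv y z n else 0)"
    proof (cases "n \<le> m")
      case True
      then have "(\<Sum>i\<le>m. if i \<le> n then lie_bracket L (coeff y i) (coeff z (n - i)) else 0) = conv y z n"
        unfolding conv_def by (intro sum.mono_neutral_cong_right) auto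
      with True show ?thesis by simp
    qed simp
    finally show ?thesis .
  qed
  have "lie_centraliser (truncated_current m L) z = current_centraliser m z" for z
    by (auto simp: lie_centraliser_def current_centraliser_def carrier poly_eq_iff coeff_bracket)
  moreover have "lie_centraliser L v = centraliser v" for v
    by (simp add: lie_centraliser_def centraliser_def)
  moreover have "coeff x 0 \<in> carrier L"
    using x by (simp add: truncated_current_def)
  ultimately show ?thesis
    using minimal_centraliser_iff[of x m] x unfolding lie_regular_def carrier scale by simp
qed

section \<open>The Lie algebra of a linear algebraic group\<close>

lemma mat_scale_vector_space: "vector_space (mat_scale :: 'a::field \<Rightarrow> 'a^'n^'n \<Rightarrow> 'a^'n^'n)"
  by unfold_locales (simp_all add: mat_scale_def vec_eq_iff algebra_simps)

lemma finitely_spanned_matrices: "finitely_spanned mat_scale (UNIV :: ('a::field^'n^'n) set)"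
proof -
  interpret vs: vector_space "mat_scale :: 'a \<Rightarrow> 'a^'n^'n \<Rightarrow> 'a^'n^'n"
    by (rule mat_scale_vector_space)
  define E :: "'n \<times> 'n \<Rightarrow> 'a^'n^'n" where "E = (\<lambda>(k, l). \<chi> i j. if i = k \<and> j = l then 1 else 0)"
  have "X \<in> vs.span (range E)" for X
  proof -
    have "X = (\<Sum>k\<in>UNIV. \<Sum>l\<in>UNIV. mat_scale (X $ k $ l) (E (k, l)))"
    proof -
      have "(\<Sum>k\<in>UNIV. \<Sum>l\<in>UNIV. mat_scale (X $ k $ l) (E (k, l))) $ i $ j = X $ i $ j" for i j
      proof -
        have "(\<Sum>l\<in>UNIV. mat_scale (X $ k $ l) (E (k, l))) $ i $ j = (if k = i then X $ k $ j else 0)" for k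
          by (cases "k = i") (simp_all add: mat_scale_def E_def if_distrib cong: if_cong)
        then show ?thesis by simp
      qed
      then show ?thesis by (simp add: vec_eq_iff)
    qed
    also have "\<dots> \<in> vs.span (range E)"
      by (intro vs.span_sum vs.span_scale vs.span_base) auto
    finally show ?thesis .
  qed
  then show ?thesis unfolding finitely_spanned_def by (intro exI[of _ "range E"]) auto
qed

lemma matrix_commutator_linear:
  fixes X :: "'a::field^'n^'n"
  shows "Vector_Spaces.linear mat_scale mat_scale (\<lambda>Y. Y ** X - X ** Y)"
    and "Vector_Spaces.linear mat_scale mat_scale (\<lambda>Y. X ** Y - Y ** X)"
  by (simp_all add: Vector_Spaces.linear_iff mat_scale_vector_space vec_eq_iff mat_scale_def
      matrix_matrix_mult_def sum.distrib sum_distrib_left algebra_simps)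

text \<open>
  \<open>Lie G\<close> is cut out by differentials, which are linear in the direction.
\<close>

lemma Lie_subspace:
  fixes G :: "('a::field^'n^'n) set"
  shows "module.subspace mat_scale (carrier (Lie G))"
proof -
  interpret vs: vector_space "mat_scale :: 'a \<Rightarrow> 'a^'n^'n \<Rightarrow> 'a^'n^'n"
    by (rule mat_scale_vector_space)
  have zero: "poly_differential f a (entries 0) = 0"
    and add: "poly_differential f a (entries (X + Y)) =
      poly_differential f a (entries X) + poly_differential f a (entries Y)"
    and scale: "poly_differential f a (entries (mat_scale c X)) = c * poly_differential f a (entries X)"
    for f :: "('n \<times> 'n \<Rightarrow>\<^sub>0 nat) \<Rightarrow>\<^sub>0 'a" and a c and X Y :: "'a^'n^'n"
  proof -
    have e: "entries 0 v = 0" "entries (X + Y) v = entries X v + entries Y v"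
      "entries (mat_scale c X) v = c * entries X v" for v :: "'n \<times> 'n"
      by (auto simp: entries_def mat_scale_def split: prod.split)
    show "poly_differential f a (entries 0) = 0"
      "poly_differential f a (entries (X + Y)) =
        poly_differential f a (entries X) + poly_differential f a (entries Y)"
      by (simp_all add: poly_differential_def e distrib_left sum.distrib)
    show "poly_differential f a (entries (mat_scale c X)) = c * poly_differential f a (entries X)"
      by (simp add: poly_differential_def e sum_distrib_left mult_ac)
  qed
  show ?thesis
    unfolding vs.subspace_def Lie_def by (simp add: zero add scale)
qed

theorem theorem3p7:
  fixes G :: "('a::alg_closed_field^'n^'n) set"
    and m :: nat
    and x :: "('a^'n^'n) poly"
  assumes "CHAR('a) > 0"
    and "standard_reductive G"
    and "m > 0"
    and "x \<in> carrier (truncated_current m (Lie G))"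
  shows "lie_regular (Lie G) (coeff x 0) \<longleftrightarrow> lie_regular (truncated_current m (Lie G)) x"
proof (rule lie_regular_truncated_current_iff[OF _ assms(4)])
  have "finitely_spanned mat_scale (carrier (Lie G))"
    by (rule finitely_spanned_subset[OF mat_scale_vector_space finitely_spanned_matrices subset_UNIV])
  moreover have "lie_scale (Lie G) = mat_scale" "lie_bracket (Lie G) = (\<lambda>X Y. X ** Y - Y ** X)"
    by (simp_all add: Lie_def)
  ultimately show "bilinear_product (lie_scale (Lie G)) (carrier (Lie G)) (lie_bracket (Lie G))"
    by (simp add: bilinear_product_def bilinear_product_axioms_def mat_scale_vector_space
        Lie_subspace matrix_commutator_linear infinite_alg_closed_field)
qed

end
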